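(* Let $(V,\langle\cdot,\cdot\rangle,\omega)$ be a symplectic Hilbert space. Then any countable family of Lagrangian subspaces of $V$ admits a common complementary Lagrangian; that is, if $(L_n)_{n}$ is a countable family of Lagrangian subspaces of $V$, there exists a Lagrangian subspace $L'\subset V$ such that $V=L_n\oplus L'$ for every $n$.
   Context: A symplectic Hilbert space is a real Hilbert space $(V,\langle\cdot,\cdot\rangle)$ endowed with a symplectic form, i.e. a bounded anti-symmetric bilinear form $\omega:V\times V\to\mathbb{R}$ that is represented by an (anti-self-adjoint) linear isomorphism $H:V\to V$, meaning $\omega=\langle H\cdot,\cdot\rangle$. A subspace $S$ of $V$ is isotropic if $\omega$ vanishes on $S\times S$. A Lagrangian subspace of $V$ is a maximal (with respect to inclusion) isotropic subspace of $V$. If $L\subset V$ is Lagrangian, a complementary Lagrangian to $L$ is a Lagrangian $L'\subset V$ with $V=L\oplus L'$ (i.e. $L\cap L'=\{0\}$ and $L+L'=V$; the sum need not be orthogonal). *)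

theory Defs
  imports "HOL-Analysis.Analysis"
begin

text \<open>
  A real Hilbert space is a type of class \<open>{real_inner, complete_space}\<close>.  The representing
  isomorphism \<open>H\<close> is only required to be linear and bijective: anti-self-adjointness follows from
  antisymmetry of the form, boundedness of \<open>H\<close> from boundedness of the form, and boundedness of
  the inverse from the open mapping theorem.
\<close>

definition symplectic_form :: "('a::{real_inner, complete_space} \<Rightarrow> 'a \<Rightarrow> real) \<Rightarrow> bool" where
  "symplectic_form \<omega> \<longleftrightarrow>
     bounded_bilinear \<omega> \<and>
     (\<forall>x y. \<omega> x y = - \<omega> y x) \<and>
     (\<exists>H. linear H \<and> bij H \<and> (\<forall>x y. \<omega> x y = H x \<bullet> y))"

definition isotropic :: "('a::{real_inner, complete_space} \<Rightarrow> 'a \<Rightarrow> real) \<Rightarrow> 'a set \<Rightarrow> bool" where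
  "isotropic \<omega> S \<longleftrightarrow> subspace S \<and> (\<forall>x\<in>S. \<forall>y\<in>S. \<omega> x y = 0)"

text \<open>
  Subspaces are not assumed closed; a maximal isotropic subspace is automatically closed, because
  the closure of an isotropic subspace is isotropic.
\<close>

definition lagrangian :: "('a::{real_inner, complete_space} \<Rightarrow> 'a \<Rightarrow> real) \<Rightarrow> 'a set \<Rightarrow> bool" where
  "lagrangian \<omega> L \<longleftrightarrow> isotropic \<omega> L \<and> (\<forall>S. isotropic \<omega> S \<and> L \<subseteq> S \<longrightarrow> S = L)"

definition complementary :: "'a::real_vector set \<Rightarrow> 'a set \<Rightarrow> bool" where
  "complementary S T \<longleftrightarrow> S \<inter> T = {0} \<and> {x + y | x y. x \<in> S \<and> y \<in> T} = UNIV"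

end

theory Submission imports Defs begin

text \<open>
  Taking \<open>G\<close>, the square root of \<open>\<bar>H\<bar>\<close>, as a change of variables reduces the form to a multiple of \<open>\<langle>J x, y\<rangle>\<close> with
  \<open>J\<^sup>2 = -1\<close>.  Lagrangian subspaces then correspond to the symmetric involutions \<open>R\<close> with
  \<open>R J = - J R\<close>, which form a complete metric space, and two of them are complementary if
  \<open>R - S\<close> is bounded below.  For fixed \<open>S\<close> this is an open condition on \<open>R\<close>.  It is also dense:
  \<open>Y = J (R S - S R) / 2\<close> is symmetric and commutes with \<open>R\<close>, \<open>S\<close>, \<open>J\<close>, hence so does its sign \<open>\<Sigma>\<close>, and
  \<open>R (cos \<theta> + sin \<theta> J \<Sigma>)\<close> has the property for all small \<open>\<theta> > 0\<close>.  The Baire category theorem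
  concludes.
\<close>

section \<open>Hilbert space preliminaries\<close>

text \<open>The parallelogram identity makes a minimizing sequence for the distance from
  \<open>x\<close> to \<open>N\<close> Cauchy. Its limit is a nearest point, and minimality along
  the lines through it inside \<open>N\<close> gives orthogonality.\<close>

lemma orthogonal_decomposition:
  fixes N :: "'a::{real_inner, complete_space} set"
  assumes "closed N" "subspace N"
  obtains n where "n \<in> N" "\<And>y. y \<in> N \<Longrightarrow> (x - n) \<bullet> y = 0"
proof -
  define d where "d = infdist x N"
  have N0: "N \<noteq> {}"
    using assms(2) subspace_0 by blast
  have d0: "d \<ge> 0"
    by (simp add: d_def infdist_nonneg)
  have dle: "d \<le> norm (x - u)" if "u \<in> N" for u
    using infdist_le[OF that, of x] by (simp add: d_def dist_norm)
  have "\<exists>u\<in>N. (norm (x - u))\<^sup>2 < d\<^sup>2 + 1 / real (Suc k)" for k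
  proof -
    have "d < sqrt (d\<^sup>2 + 1 / real (Suc k))"
      using d0 by (intro real_less_rsqrt) auto
    then obtain u where "u \<in> N" "dist x u < sqrt (d\<^sup>2 + 1 / real (Suc k))"
      using infdist_notempty[OF N0, of x] N0
        cInf_lessD[of "dist x ` N" "sqrt (d\<^sup>2 + 1 / real (Suc k))"]
      by (auto simp: d_def)
    moreover from this(2) have "(dist x u)\<^sup>2 < (sqrt (d\<^sup>2 + 1 / real (Suc k)))\<^sup>2"
      by (intro power_strict_mono) auto
    then have "(dist x u)\<^sup>2 < d\<^sup>2 + 1 / real (Suc k)"
      by (simp add: add_nonneg_nonneg)
    ultimately show ?thesis
      by (auto simp: dist_norm)
  qed
  then obtain u where uN: "\<And>k. u k \<in> N"
    and u: "\<And>k. (norm (x - u k))\<^sup>2 < d\<^sup>2 + 1 / real (Suc k)"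
    by metis
  have close: "(norm (u k - u l))\<^sup>2 \<le> 2 / real (Suc k) + 2 / real (Suc l)" for k l
  proof -
    have "(1/2) *\<^sub>R (u k + u l) \<in> N"
      using assms(2) uN by (simp add: subspace_add subspace_scale)
    then have "d\<^sup>2 \<le> (norm (x - (1/2) *\<^sub>R (u k + u l)))\<^sup>2"
      using d0 dle by (simp add: power_mono)
    moreover have "(norm (u k - u l))\<^sup>2 + 4 * (norm (x - (1/2) *\<^sub>R (u k + u l)))\<^sup>2
        = 2 * (norm (x - u k))\<^sup>2 + 2 * (norm (x - u l))\<^sup>2"
      unfolding power2_norm_eq_inner by (simp add: algebra_simps inner_commute)
    ultimately show ?thesis
      using u[of k] u[of l] by linarith
  qed
  have "Cauchy u"
  proof (rule metric_CauchyI)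
    fix e :: real
    assume "e > 0"
    obtain M :: nat where "4 / e\<^sup>2 < real M"
      using reals_Archimedean2 by blast
    moreover have "0 < 4 / e\<^sup>2"
      using \<open>e > 0\<close> by simp
    ultimately have "0 < real M"
      by (rule less_trans[rotated])
    with \<open>4 / e\<^sup>2 < real M\<close> \<open>e > 0\<close> have M: "M > 0" "4 / real M < e\<^sup>2"
      by (auto simp: field_simps)
    have "dist (u k) (u l) < e" if "k \<ge> M" "l \<ge> M" for k l
    proof -
      have "2 / real (Suc k) \<le> 2 / real M" "2 / real (Suc l) \<le> 2 / real M"
        using that M(1) by (auto intro!: divide_left_mono)
      then have "(norm (u k - u l))\<^sup>2 < e\<^sup>2"
        using close[of k l] M(2) by simp
      then show ?thesis
        using \<open>e > 0\<close> by (simp add: dist_norm power_less_imp_less_base)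
    qed
    then show "\<exists>M. \<forall>k\<ge>M. \<forall>l\<ge>M. dist (u k) (u l) < e"
      by blast
  qed
  then obtain n where n: "u \<longlonglongrightarrow> n"
    using Cauchy_convergent convergent_def by blast
  have nN: "n \<in> N"
    using closed_sequentially[OF assms(1)] uN n by blast
  have "(\<lambda>k. (norm (x - u k))\<^sup>2) \<longlonglongrightarrow> (norm (x - n))\<^sup>2"
    by (intro tendsto_intros n)
  moreover have "(\<lambda>k. d\<^sup>2 + 1 / real (Suc k)) \<longlonglongrightarrow> d\<^sup>2 + 0"
    by (intro tendsto_intros LIMSEQ_Suc[OF lim_1_over_n])
  ultimately have "(norm (x - n))\<^sup>2 \<le> d\<^sup>2 + 0"
    by (rule LIMSEQ_le) (use u in \<open>auto intro: less_imp_le\<close>)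
  then have min: "(norm (x - n))\<^sup>2 \<le> d\<^sup>2"
    by simp
  have "(x - n) \<bullet> y = 0" if "y \<in> N" for y
  proof (cases "y = 0")
    case False
    \<comment> \<open>This \<open>t\<close> minimizes the quadratic function sending
      \<open>t\<close> to the squared norm of \<open>x - (n + t *\<^sub>R y)\<close>.\<close>
    define t where "t = (x - n) \<bullet> y / (y \<bullet> y)"
    have "n + t *\<^sub>R y \<in> N"
      using assms(2) nN that by (simp add: subspace_add subspace_scale)
    then have "d\<^sup>2 \<le> (norm (x - (n + t *\<^sub>R y)))\<^sup>2"
      using d0 dle by (simp add: power_mono)
    moreover have "(norm (x - (n + t *\<^sub>R y)))\<^sup>2
        = (norm (x - n))\<^sup>2 - 2 * t * ((x - n) \<bullet> y) + t * t * (y \<bullet> y)"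
      unfolding power2_norm_eq_inner by (simp add: algebra_simps inner_commute)
    moreover have "t * (y \<bullet> y) = (x - n) \<bullet> y"
      using False by (simp add: t_def)
    ultimately have "t * ((x - n) \<bullet> y) \<le> 0"
      using min by (simp add: mult.assoc)
    then have "((x - n) \<bullet> y)\<^sup>2 / (y \<bullet> y) \<le> 0"
      by (simp add: t_def power2_eq_square)
    moreover have "y \<bullet> y > 0"
      using False by simp
    ultimately show ?thesis
      by (simp add: divide_le_0_iff)
  qed simp
  with nN show thesis
    using that by blast
qed

section \<open>Square roots by iteration\<close>

text \<open>Expanding the square gives |x|^2 - 2 |H x|^2 + |K H x|^2, whose last term is at most |H
  x|^2. It supplies the contraction hypothesis when a square root of \<open>K H\<close> is
  extracted.\<close>

lemma norm_diff_adjoint_square_le: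
  fixes H K :: "'a::real_inner \<Rightarrow> 'a"
  assumes adj: "\<And>x y. H x \<bullet> y = x \<bullet> K y"
    and K: "\<And>x. norm (K x) \<le> norm x"
  shows "norm (x - K (H x)) \<le> norm x"
proof -
  have "(norm (K (H x)))\<^sup>2 \<le> (norm (H x))\<^sup>2"
    by (intro power_mono K norm_ge_zero)
  moreover have "(norm (x - K (H x)))\<^sup>2 = (norm x)\<^sup>2 - 2 * (x \<bullet> K (H x)) + (norm (K (H x)))\<^sup>2"
    unfolding power2_norm_eq_inner
    by (simp add: inner_diff_left inner_diff_right inner_commute[of "K (H x)" x])
  moreover have "x \<bullet> K (H x) = (norm (H x))\<^sup>2"
    by (simp only: adj[symmetric] power2_norm_eq_inner)
  moreover have "0 \<le> (norm (H x))\<^sup>2"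
    by simp
  ultimately have "(norm (x - K (H x)))\<^sup>2 \<le> (norm x)\<^sup>2"
    by linarith
  then show ?thesis
    by (rule power2_le_imp_le) simp
qed

text \<open>A fixed point Y of this recursion satisfies (1 - Y)^2 = 1 - B, so 1 - Y is a square root
  of 1 - B.\<close>

fun sqrt_iter :: "('a::real_vector \<Rightarrow> 'a) \<Rightarrow> nat \<Rightarrow> 'a \<Rightarrow> 'a" where
  "sqrt_iter B 0 x = 0"
| "sqrt_iter B (Suc n) x = (1/2) *\<^sub>R (B x + sqrt_iter B n (sqrt_iter B n x))"

fun sqrt_bound :: "nat \<Rightarrow> real" where
  "sqrt_bound 0 = 0"
| "sqrt_bound (Suc n) = (1 + sqrt_bound n * sqrt_bound n) / 2"

lemma sqrt_bound_ge0: "0 \<le> sqrt_bound n"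
  by (induction n) auto

lemma sqrt_bound_le1: "sqrt_bound n \<le> 1"
proof (induction n)
  case (Suc n)
  then show ?case
    using mult_le_one[OF Suc sqrt_bound_ge0 Suc] by simp
qed simp

lemma sqrt_bound_incseq: "incseq sqrt_bound"
proof (rule incseq_SucI)
  fix n
  show "sqrt_bound n \<le> sqrt_bound (Suc n)"
    using zero_le_square[of "1 - sqrt_bound n"] by (simp add: algebra_simps)
qed

lemma linear_sqrt_iter:
  assumes "linear B"
  shows "linear (sqrt_iter B n)"
proof (induction n)
  case 0
  show ?case
    by (auto intro: linearI)
next
  case (Suc n)
  show ?case
    by (rule linearI)
      (simp_all add: linear_add[OF assms] linear_add[OF Suc] linear_scale[OF assms]
        linear_scale[OF Suc] algebra_simps)
qed

lemma norm_sqrt_iter_le: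
  fixes B :: "'a::real_normed_vector \<Rightarrow> 'a"
  assumes "\<And>x. norm (B x) \<le> norm x"
  shows "norm (sqrt_iter B n x) \<le> sqrt_bound n * norm x"
proof (induction n arbitrary: x)
  case (Suc n)
  have "norm (sqrt_iter B n (sqrt_iter B n x)) \<le> sqrt_bound n * (sqrt_bound n * norm x)"
    by (meson Suc mult_left_mono order_trans sqrt_bound_ge0)
  then have "norm (B x + sqrt_iter B n (sqrt_iter B n x))
      \<le> norm x + sqrt_bound n * (sqrt_bound n * norm x)"
    by (intro norm_triangle_mono assms)
  then show ?case
    unfolding sqrt_iter.simps sqrt_bound.simps norm_scaleR by (simp add: field_simps)
qed simp

text \<open>For consecutive iterates y and z, z z - y y = z (z - y) + (z - y) y. The scalar iterates
  satisfy the same identity, so the bound propagates by induction.\<close>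

lemma norm_sqrt_iter_Suc_diff_le:
  fixes B :: "'a::real_normed_vector \<Rightarrow> 'a"
  assumes "linear B" "\<And>x. norm (B x) \<le> norm x"
  shows "norm (sqrt_iter B (Suc n) x - sqrt_iter B n x)
    \<le> (sqrt_bound (Suc n) - sqrt_bound n) * norm x"
proof (induction n arbitrary: x)
  case 0
  show ?case
    using assms(2)[of x] linear_0[OF assms(1)] by simp
next
  case (Suc n)
  let ?y = "sqrt_iter B n" and ?z = "sqrt_iter B (Suc n)"
  let ?b = "sqrt_bound n" and ?c = "sqrt_bound (Suc n)"
  note lin = linear_sqrt_iter[OF assms(1)]
  have c0: "0 \<le> ?c - ?b"
    using sqrt_bound_incseq by (simp add: incseq_Suc_iff del: sqrt_bound.simps)
  have "sqrt_iter B (Suc (Suc n)) x - ?z x = (1/2) *\<^sub>R (?z (?z x) - ?y (?y x))"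
    by (simp add: scaleR_diff_right scaleR_add_right del: sqrt_iter.simps(2)
        add: sqrt_iter.simps(2)[of B "Suc n"] sqrt_iter.simps(2)[of B n x])
  also have "?z (?z x) - ?y (?y x) = ?z (?z x - ?y x) + (?z (?y x) - ?y (?y x))"
    by (simp add: linear_diff[OF lin] del: sqrt_iter.simps)
  finally have eq: "sqrt_iter B (Suc (Suc n)) x - ?z x
      = (1/2) *\<^sub>R (?z (?z x - ?y x) + (?z (?y x) - ?y (?y x)))" .
  have "norm (?z (?z x - ?y x)) \<le> ?c * ((?c - ?b) * norm x)"
    using norm_sqrt_iter_le[OF assms(2), of "Suc n"] Suc mult_left_mono[OF Suc sqrt_bound_ge0]
    by (meson order_trans)
  moreover have "norm (?z (?y x) - ?y (?y x)) \<le> (?c - ?b) * (?b * norm x)"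
    using Suc[of "?y x"] norm_sqrt_iter_le[OF assms(2), of n x] mult_left_mono[OF _ c0]
    by (meson order_trans)
  ultimately have "norm (?z (?z x - ?y x) + (?z (?y x) - ?y (?y x)))
      \<le> ?c * ((?c - ?b) * norm x) + (?c - ?b) * (?b * norm x)"
    by (intro norm_triangle_mono)
  also have "\<dots> = 2 * ((sqrt_bound (Suc (Suc n)) - ?c) * norm x)"
    by (simp only: sqrt_bound.simps(2)[of "Suc n"] sqrt_bound.simps(2)[of n]) (simp add: field_simps)
  finally show ?case
    unfolding eq by (simp del: sqrt_iter.simps sqrt_bound.simps)
qed

text \<open>The binomial series for \<open>1 - sqrt (1 - B)\<close> has nonnegative coefficients with sum 1, so the
  iteration \<open>Y \<mapsto> (B + Y\<^sup>2) / 2\<close> is dominated by the scalar one at \<open>B = 1\<close>.\<close>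

lemma contraction_square_root:
  fixes B :: "'a::{real_inner, complete_space} \<Rightarrow> 'a"
  assumes B: "linear B" "\<And>x. norm (B x) \<le> norm x"
    and sym: "\<And>x y. B x \<bullet> y = x \<bullet> B y"
  obtains Z where "linear Z" "\<And>x. norm (Z x) \<le> norm x" "\<And>x y. Z x \<bullet> y = x \<bullet> Z y"
    "\<And>x. (x - Z x) - Z (x - Z x) = x - B x"
    "\<And>T x. bounded_linear T \<Longrightarrow> (\<And>y. T (B y) = B (T y)) \<Longrightarrow> T (Z x) = Z (T x)"
proof -
  let ?Y = "sqrt_iter B"
  note lin = linear_sqrt_iter[OF B(1)]
  have nY: "norm (?Y n x) \<le> norm x" for n x
    using norm_sqrt_iter_le[OF B(2), of n x] mult_right_mono[OF sqrt_bound_le1 norm_ge_zero[of x]]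
    by (smt (verit))
  have diff: "norm (?Y (n + k) x - ?Y n x) \<le> (sqrt_bound (n + k) - sqrt_bound n) * norm x" for n k x
  proof (induction k)
    case (Suc k)
    have "norm (?Y (Suc (n + k)) x - ?Y n x)
        \<le> norm (?Y (Suc (n + k)) x - ?Y (n + k) x) + norm (?Y (n + k) x - ?Y n x)"
      by (metis diff_add_cancel add_diff_eq norm_triangle_ineq)
    then show ?case
      using Suc norm_sqrt_iter_Suc_diff_le[OF B, of "n + k" x]
      by (simp add: algebra_simps del: sqrt_iter.simps sqrt_bound.simps)
  qed simp
  have "convergent sqrt_bound"
    using sqrt_bound_incseq sqrt_bound_le1 sqrt_bound_ge0
    by (intro Bseq_monoseq_convergent BseqI'[of _ 1]) (auto simp: monoseq_iff)
  then have cb: "Cauchy sqrt_bound"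
    by (simp add: Cauchy_convergent_iff)
  have "Cauchy (\<lambda>n. ?Y n x)" for x
  proof (rule metric_CauchyI)
    fix e :: real
    assume "e > 0"
    then have "e / (norm x + 1) > 0"
      by (simp add: add_nonneg_pos)
    then obtain M where M: "\<And>m n. m \<ge> M \<Longrightarrow> n \<ge> M \<Longrightarrow> \<bar>sqrt_bound m - sqrt_bound n\<bar> < e / (norm x + 1)"
      using cb unfolding Cauchy_def dist_real_def by meson
    have *: "dist (?Y m x) (?Y n x) < e" if "m \<ge> n" "n \<ge> M" for m n
    proof -
      have "norm (?Y m x - ?Y n x) \<le> (sqrt_bound m - sqrt_bound n) * norm x"
        using diff[of n "m - n" x] that by simp
      also have "\<dots> \<le> (e / (norm x + 1)) * norm x"
        using M[of m n] that by (intro mult_right_mono) auto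
      also have "\<dots> < e"
      proof -
        have "norm x + 1 > 0"
          using norm_ge_zero[of x] by linarith
        then show ?thesis
          using \<open>e > 0\<close> by (simp add: pos_divide_less_eq distrib_left)
      qed
      finally show ?thesis
        by (simp add: dist_norm)
    qed
    then have "dist (?Y m x) (?Y n x) < e" if "m \<ge> M" "n \<ge> M" for m n
      using that *[of m n] *[of n m] by (cases "n \<le> m") (auto simp: dist_commute)
    then show "\<exists>M. \<forall>m\<ge>M. \<forall>n\<ge>M. dist (?Y m x) (?Y n x) < e"
      by blast
  qed
  then have "\<exists>l. (\<lambda>n. ?Y n x) \<longlonglongrightarrow> l" for x
    using Cauchy_convergent convergent_def by blast
  then obtain Z where Z: "\<And>x. (\<lambda>n. ?Y n x) \<longlonglongrightarrow> Z x"
    by metis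
  have linZ: "linear Z"
  proof (rule linearI)
    show "Z (x + y) = Z x + Z y" for x y
      using tendsto_add[OF Z[of x] Z[of y]]
      by (intro LIMSEQ_unique[OF Z]) (simp add: linear_add[OF lin])
    show "Z (c *\<^sub>R x) = c *\<^sub>R Z x" for c x
      using tendsto_scaleR[OF tendsto_const Z[of x]]
      by (intro LIMSEQ_unique[OF Z]) (simp add: linear_scale[OF lin])
  qed
  have nZ: "norm (Z x) \<le> norm x" for x
    using LIMSEQ_le_const2[OF tendsto_norm[OF Z[of x]]] nY by blast
  have symY: "?Y n x \<bullet> y = x \<bullet> ?Y n y" for n x y
    by (induction n arbitrary: x y) (simp_all add: inner_add_left inner_add_right sym)
  have symZ: "Z x \<bullet> y = x \<bullet> Z y" for x y
    using tendsto_inner[OF Z[of x] tendsto_const[of y]] tendsto_inner[OF tendsto_const[of x] Z[of y]]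
    unfolding symY by (rule LIMSEQ_unique)
  \<comment> \<open>Operator and argument vary together: Y_n (Y_n x) = Y_n (Y_n x - Z x) + Y_n (Z
    x), and the first summand tends to 0 because all iterates are contractions.\<close>
  have YY: "(\<lambda>n. ?Y n (?Y n x)) \<longlonglongrightarrow> Z (Z x)" for x
  proof -
    have "(\<lambda>n. ?Y n (?Y n x - Z x)) \<longlonglongrightarrow> 0"
    proof (rule Lim_null_comparison)
      show "(\<lambda>n. norm (?Y n x - Z x)) \<longlonglongrightarrow> 0"
        using Z[of x] tendsto_norm_zero LIM_zero by blast
    qed (use nY in auto)
    from tendsto_add[OF this Z[of "Z x"]] show ?thesis
      by (simp add: linear_diff[OF lin])
  qed
  have fix_eq: "Z x = (1/2) *\<^sub>R (B x + Z (Z x))" for x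
  proof -
    have "(\<lambda>n. ?Y (Suc n) x) \<longlonglongrightarrow> (1/2) *\<^sub>R (B x + Z (Z x))"
      unfolding sqrt_iter.simps by (intro tendsto_intros YY)
    then show ?thesis
      using LIMSEQ_Suc[OF Z[of x]] LIMSEQ_unique by blast
  qed
  have root: "(x - Z x) - Z (x - Z x) = x - B x" for x
  proof -
    have "2 *\<^sub>R Z x = B x + Z (Z x)"
      using arg_cong[OF fix_eq[of x], of "\<lambda>v. 2 *\<^sub>R v"] by simp
    then show ?thesis
      by (simp add: linear_diff[OF linZ] scaleR_2 algebra_simps)
  qed
  \<comment> \<open>Each iterate is a polynomial in \<open>B\<close>, hence commutes with
    \<open>T\<close>; continuity of \<open>T\<close> carries this to the limit.\<close>
  have comm: "T (Z x) = Z (T x)"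
    if T: "bounded_linear T" and comm: "\<And>y. T (B y) = B (T y)" for T x
  proof -
    interpret T: bounded_linear T
      by (fact T)
    have "T (?Y n x) = ?Y n (T x)" for n x
      by (induction n arbitrary: x) (simp_all add: T.zero T.add T.scaleR comm)
    then have "(\<lambda>n. ?Y n (T x)) \<longlonglongrightarrow> T (Z x)"
      using T.tendsto[OF Z[of x]] by simp
    then show ?thesis
      using Z by (rule LIMSEQ_unique)
  qed
  show thesis
    by (rule that[OF linZ nZ symZ root comm])
qed

section \<open>Reflections in closed subspaces and signs of symmetric operators\<close>

lemma closed_subspace_reflection:
  fixes N :: "'a::{real_inner, complete_space} set"
  assumes N: "closed N" "subspace N"
  obtains Q where "linear Q" "\<And>x. Q (Q x) = x" "\<And>x y. Q x \<bullet> y = x \<bullet> Q y"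
    "\<And>x. x + Q x \<in> N" "\<And>x y. y \<in> N \<Longrightarrow> (x - Q x) \<bullet> y = 0"
    "\<And>a b. a \<in> N \<Longrightarrow> (\<And>y. y \<in> N \<Longrightarrow> b \<bullet> y = 0) \<Longrightarrow> Q (a + b) = a - b"
proof -
  have "\<exists>n. n \<in> N \<and> (\<forall>y\<in>N. (x - n) \<bullet> y = 0)" for x
    using orthogonal_decomposition[OF N, of x] by metis
  then obtain P where PN: "\<And>x. P x \<in> N" and orth: "\<And>x y. y \<in> N \<Longrightarrow> (x - P x) \<bullet> y = 0"
    by metis
  \<comment> \<open>Uniqueness of the decomposition: \<open>P (a + b) - a\<close> lies in
    \<open>N\<close> and equals the difference of \<open>b\<close> and
    \<open>a + b - P (a + b)\<close>, both orthogonal to \<open>N\<close>; so it is orthogonal to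
    itself.\<close>
  have P_eq: "P (a + b) = a" if a: "a \<in> N" and b: "\<And>y. y \<in> N \<Longrightarrow> b \<bullet> y = 0" for a b
  proof -
    have "P (a + b) - a \<in> N"
      using subspace_diff[OF N(2) PN a] .
    then have "(b - (a + b - P (a + b))) \<bullet> (P (a + b) - a) = 0"
      by (simp only: inner_diff_left[of b] b orth)
    then show ?thesis
      by simp
  qed
  define Q where "Q x = 2 *\<^sub>R P x - x" for x
  have Q_eq: "Q (a + b) = a - b" if "a \<in> N" "\<And>y. y \<in> N \<Longrightarrow> b \<bullet> y = 0" for a b
    using P_eq[OF that] by (simp add: Q_def scaleR_2)
  have addP: "P (x + y) = P x + P y" for x y
    using P_eq[of "P x + P y" "(x - P x) + (y - P y)"] subspace_add[OF N(2) PN PN] orth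
    by (simp add: inner_add_left)
  have scaleP: "P (c *\<^sub>R x) = c *\<^sub>R P x" for c x
    using P_eq[of "c *\<^sub>R P x" "c *\<^sub>R (x - P x)"] subspace_scale[OF N(2) PN] orth
    by (simp add: scaleR_diff_right[symmetric] del: scaleR_diff_right) (simp add: scaleR_diff_right)
  have "linear Q"
    by (rule linearI) (simp_all add: Q_def addP scaleP algebra_simps)
  moreover have "Q (Q x) = x" for x
    using Q_eq[of "P x" "- (x - P x)"] PN orth[of _ x]
    by (simp add: Q_def scaleR_2 inner_minus_left del: minus_diff_eq) (simp add: algebra_simps)
  moreover have "Q x \<bullet> y = x \<bullet> Q y" for x y
    using orth[OF PN, of x y] orth[OF PN, of y x]
    by (simp add: Q_def inner_diff_left inner_diff_right inner_commute)
  moreover have "x + Q x \<in> N" for x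
    using subspace_scale[OF N(2) PN] by (simp add: Q_def)
  moreover have "(x - Q x) \<bullet> y = 0" if "y \<in> N" for x y
    using orth[OF that, of x] by (simp add: Q_def inner_diff_left)
  ultimately show thesis
    using Q_eq by (rule that)
qed

lemma bounded_linearI_contraction:
  assumes "linear T" "\<And>x. norm (T x) \<le> norm x"
  shows "bounded_linear T"
  using assms by (intro bounded_linear_intro[of _ 1]) (auto simp: linear_add linear_scale)

text \<open>Let \<open>W\<close> = |Y| be the square root of Y^2 and \<open>N\<close> the kernel of
  \<open>W - Y\<close>. The reflection in \<open>N\<close> serves as the sign: \<open>Y\<close>
  equals \<open>W\<close> on \<open>N\<close> and \<open>- W\<close> on its orthogonal complement,
  so Y \<Sigma> = W is nonnegative. Both \<open>T\<close> and its adjoint \<open>T'\<close> are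
  assumed to commute with \<open>Y\<close> so that \<open>T\<close> preserves \<open>N\<close> as
  well as its complement.\<close>

lemma sign_operator:
  fixes Y :: "'a::{real_inner, complete_space} \<Rightarrow> 'a"
  assumes lin: "linear Y" and contr: "\<And>x. norm (Y x) \<le> norm x"
    and sym: "\<And>x y. Y x \<bullet> y = x \<bullet> Y y"
  obtains \<Sigma> where "linear \<Sigma>" "\<And>x. \<Sigma> (\<Sigma> x) = x" "\<And>x y. \<Sigma> x \<bullet> y = x \<bullet> \<Sigma> y"
    "\<And>x. 0 \<le> Y (\<Sigma> x) \<bullet> x"
    "\<And>T T' x. bounded_linear T \<Longrightarrow> bounded_linear T' \<Longrightarrow> (\<And>x y. T x \<bullet> y = x \<bullet> T' y) \<Longrightarrow>
      (\<And>x. T (Y x) = Y (T x)) \<Longrightarrow> (\<And>x. T' (Y x) = Y (T' x)) \<Longrightarrow> T (\<Sigma> x) = \<Sigma> (T x)"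
proof -
  note blY = bounded_linearI_contraction[OF lin contr]
  let ?B = "\<lambda>x. x - Y (Y x)"
  have linB: "linear ?B"
    by (rule linearI) (simp_all add: linear_add[OF lin] linear_scale[OF lin] algebra_simps)
  obtain Z where Z: "linear Z" "\<And>x. norm (Z x) \<le> norm x" "\<And>x y. Z x \<bullet> y = x \<bullet> Z y"
    and root: "\<And>x. (x - Z x) - Z (x - Z x) = x - ?B x"
    and commZ: "\<And>T x. bounded_linear T \<Longrightarrow> (\<And>y. T (?B y) = ?B (T y)) \<Longrightarrow> T (Z x) = Z (T x)"
  proof (rule contraction_square_root[of ?B])
    show "norm (?B x) \<le> norm x" for x
      using sym contr by (rule norm_diff_adjoint_square_le)
    show "?B x \<bullet> y = x \<bullet> ?B y" for x y
      by (simp add: inner_diff_left inner_diff_right sym)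
  qed (use linB in auto)
  define W where "W x = x - Z x" for x
  have linW: "linear W"
    unfolding W_def by (rule linearI) (simp_all add: linear_add[OF Z(1)] linear_scale[OF Z(1)] algebra_simps)
  have WW: "W (W x) = Y (Y x)" for x
    using root[of x] by (simp add: W_def)
  \<comment> \<open>Since \<open>Z\<close> is a contraction, the inner product of \<open>Z x\<close>
    and \<open>x\<close> is at most |x|^2.\<close>
  have W_pos: "0 \<le> W x \<bullet> x" for x
    using norm_cauchy_schwarz[of "Z x" x] mult_right_mono[OF Z(2)[of x] norm_ge_zero[of x]]
    by (simp add: W_def inner_diff_left power2_norm_eq_inner[symmetric] power2_eq_square)
  have symW: "W x \<bullet> y = x \<bullet> W y" for x y
    by (simp add: W_def inner_diff_left inner_diff_right Z(3))
  have commW: "T (W x) = W (T x)" if "bounded_linear T" "\<And>x. T (Y x) = Y (T x)" for T x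
    using commZ[OF that(1)] linear_diff[OF bounded_linear.linear[OF that(1)]] that(2)
    by (simp add: W_def)
  define N where "N = {x. W x = Y x}"
  have "bounded_linear Z"
    using bounded_linearI_contraction[OF Z(1,2)] .
  then have "bounded_linear W"
    unfolding W_def by (intro bounded_linear_sub bounded_linear_ident)
  then have "closed N"
    unfolding N_def using blY by (intro closed_Collect_eq linear_continuous_on)
  moreover have "subspace N"
    unfolding N_def
    by (rule subspaceI) (simp_all add: linear_0 linear_add linear_scale lin linW)
  ultimately obtain Q where Q: "linear Q" "\<And>x. Q (Q x) = x" "\<And>x y. Q x \<bullet> y = x \<bullet> Q y"
    and QN: "\<And>x. x + Q x \<in> N" and Qorth: "\<And>x y. y \<in> N \<Longrightarrow> (x - Q x) \<bullet> y = 0"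
    and Q_eq: "\<And>a b. a \<in> N \<Longrightarrow> (\<And>y. y \<in> N \<Longrightarrow> b \<bullet> y = 0) \<Longrightarrow> Q (a + b) = a - b"
    by (rule closed_subspace_reflection) blast
  \<comment> \<open>\<open>W\<close> and \<open>Y\<close> commute, so (W - Y) (W + Y) = W^2 - Y^2 =
    0.\<close>
  have in_N: "W u + Y u \<in> N" for u
    using commW[OF blY, of u] by (simp add: N_def linear_add[OF lin] linear_add[OF linW] WW)
  have YQ: "Y (Q x) = W x" for x
  proof -
    \<comment> \<open>The component \<open>b\<close> is orthogonal to \<open>N\<close>, which
      contains the range of \<open>W + Y\<close>. By symmetry |(W + Y) b|^2 is the inner product of
      \<open>b\<close> with (W + Y)^2 b, hence zero.\<close>
    define b where "b = x - Q x"
    have "(W b + Y b) \<bullet> (W b + Y b) = b \<bullet> (W (W b + Y b) + Y (W b + Y b))"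
      by (simp only: inner_add_left[of "W b"] symW sym inner_add_right[of b "W (W b + Y b)"])
    also have "\<dots> = 0"
      using Qorth[OF in_N[of "W b + Y b"], of x] by (simp only: b_def)
    finally have Wb: "W b = - Y b"
      by (simp add: eq_neg_iff_add_eq_0)
    have "W (x + Q x) = Y (x + Q x)"
      using QN[of x] by (simp add: N_def)
    then have "W x + W (Q x) = Y x + Y (Q x)" "W x - W (Q x) = Y (Q x) - Y x"
      using Wb by (simp_all add: b_def linear_add[OF lin] linear_add[OF linW] linear_diff[OF lin] linear_diff[OF linW])
    then have "(W x + W (Q x)) + (W x - W (Q x)) = (Y x + Y (Q x)) + (Y (Q x) - Y x)"
      by (simp only:)
    then have "2 *\<^sub>R W x = 2 *\<^sub>R Y (Q x)"
      by (simp add: scaleR_2)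
    then show ?thesis
      by simp
  qed
  have comm: "T (Q x) = Q (T x)"
    if T: "bounded_linear T" "bounded_linear T'" and adj: "\<And>x y. T x \<bullet> y = x \<bullet> T' y"
      and comm: "\<And>x. T (Y x) = Y (T x)" "\<And>x. T' (Y x) = Y (T' x)" for T T' x
  proof -
    note linT = bounded_linear.linear[OF T(1)]
    have TN: "T n \<in> N" if "n \<in> N" for n
      using that commW[OF T(1) comm(1), of n] comm(1)[of n] by (simp add: N_def)
    have T'N: "T' n \<in> N" if "n \<in> N" for n
      using that commW[OF T(2) comm(2), of n] comm(2)[of n] by (simp add: N_def)
    have "Q (T (x + Q x) + T (x - Q x)) = T (x + Q x) - T (x - Q x)"
      using QN Qorth by (intro Q_eq TN) (simp_all add: adj T'N)
    then have "2 *\<^sub>R Q (T x) = 2 *\<^sub>R T (Q x)"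
      by (simp add: linear_add[OF linT] linear_diff[OF linT] scaleR_2 linear_add[OF Q(1), symmetric])
    then show ?thesis
      by simp
  qed
  have pos: "0 \<le> Y (Q x) \<bullet> x" for x
    by (simp add: YQ W_pos)
  show thesis
    by (rule that[OF Q pos comm])
qed


section \<open>Lagrangian subspaces and their reflections\<close>

text \<open>Zorn's lemma applies because any two vectors in the union of a chain already lie in one
  member. This settles the empty family.\<close>

lemma lagrangian_exists:
  assumes "bounded_bilinear \<omega>"
  shows "\<exists>L. lagrangian \<omega> L"
proof -
  let ?A = "{S. isotropic \<omega> S}"
  have "\<exists>M\<in>?A. \<forall>X\<in>?A. M \<subseteq> X \<longrightarrow> X = M"
  proof (rule subset_Zorn_nonempty)
    have "isotropic \<omega> {0}"
      using bounded_bilinear.zero_left[OF assms] by (simp add: isotropic_def)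
    then show "?A \<noteq> {}"
      by blast
  next
    fix C
    assume C: "C \<noteq> {}" "subset.chain ?A C"
    have common: "\<exists>S\<in>C. x \<in> S \<and> y \<in> S" if "x \<in> \<Union>C" "y \<in> \<Union>C" for x y
      using that C(2) unfolding subset_chain_def by blast
    have iso: "subspace S" "\<And>x y. x \<in> S \<Longrightarrow> y \<in> S \<Longrightarrow> \<omega> x y = 0" if "S \<in> C" for S
      using that C(2) unfolding subset_chain_def isotropic_def by auto
    have "subspace (\<Union>C)"
    proof (rule subspaceI)
      show "0 \<in> \<Union>C"
        using C(1) iso(1) subspace_0 by blast
      show "x + y \<in> \<Union>C" if "x \<in> \<Union>C" "y \<in> \<Union>C" for x y
        using common[OF that] iso(1) subspace_add by blast
      show "c *\<^sub>R x \<in> \<Union>C" if "x \<in> \<Union>C" for c x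
        using that iso(1) subspace_scale by blast
    qed
    moreover have "\<omega> x y = 0" if "x \<in> \<Union>C" "y \<in> \<Union>C" for x y
      using common[OF that] iso(2) by blast
    ultimately show "\<Union>C \<in> ?A"
      by (simp add: isotropic_def)
  qed
  then show ?thesis
    by (auto simp: lagrangian_def)
qed

section \<open>Transport along linear bijections\<close>

text \<open>Only the vanishing of the two forms is compared, which allows for the scalar factor in
  the normal form of \<omega>.\<close>

lemma isotropic_image_iff:
  assumes "linear G" "bij G" and "\<And>x y. \<omega>' (G x) (G y) = 0 \<longleftrightarrow> \<omega> x y = 0"
  shows "isotropic \<omega>' (G ` S) \<longleftrightarrow> isotropic \<omega> S"
proof -
  have "G -` G ` S = S"
    using assms(2) by (simp add: bij_is_inj inj_vimage_image_eq)
  then have "subspace (G ` S) \<longleftrightarrow> subspace S"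
    using linear_subspace_image[OF assms(1), of S] linear_subspace_vimage[OF assms(1), of "G ` S"]
    by auto
  then show ?thesis
    using assms(3) by (simp add: isotropic_def)
qed

lemma lagrangian_image_iff:
  assumes "linear G" "bij G" and "\<And>x y. \<omega>' (G x) (G y) = 0 \<longleftrightarrow> \<omega> x y = 0"
  shows "lagrangian \<omega>' (G ` L) \<longleftrightarrow> lagrangian \<omega> L"
proof -
  have "(\<forall>S. isotropic \<omega>' S \<and> G ` L \<subseteq> S \<longrightarrow> S = G ` L)
    \<longleftrightarrow> (\<forall>S. isotropic \<omega>' (G ` S) \<and> G ` L \<subseteq> G ` S \<longrightarrow> G ` S = G ` L)"
    by (metis assms(2) bij_is_surj surj_image_vimage_eq)
  then show ?thesis
    using isotropic_image_iff[where \<omega> = \<omega> and \<omega>' = \<omega>', OF assms] bij_is_inj[OF assms(2)]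
    by (simp add: lagrangian_def inj_image_subset_iff inj_image_eq_iff)
qed

lemma complementary_image_iff:
  assumes "linear G" "bij G"
  shows "complementary (G ` S) (G ` T) \<longleftrightarrow> complementary S T"
proof -
  have inj: "inj G" and surj: "surj G"
    using assms(2) by (simp_all add: bij_is_inj bij_is_surj)
  have "G ` S \<inter> G ` T = G ` (S \<inter> T)" "{0} = G ` {0}"
    by (simp_all add: image_Int[OF inj] linear_0[OF assms(1)])
  then have "G ` S \<inter> G ` T = {0} \<longleftrightarrow> S \<inter> T = {0}"
    by (simp only: inj_image_eq_iff[OF inj])
  moreover have "{x + y |x y. x \<in> G ` S \<and> y \<in> G ` T} = G ` {x + y |x y. x \<in> S \<and> y \<in> T}"
    (is "?A = G ` ?B")
  proof
    show "?A \<subseteq> G ` ?B"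
    proof
      fix z
      assume "z \<in> ?A"
      then obtain x y where "z = G x + G y" "x \<in> S" "y \<in> T"
        by blast
      then show "z \<in> G ` ?B"
        unfolding linear_add[OF assms(1), symmetric] by blast
    qed
    show "G ` ?B \<subseteq> ?A"
      using linear_add[OF assms(1)] by blast
  qed
  then have "?A = UNIV \<longleftrightarrow> {x + y |x y. x \<in> S \<and> y \<in> T} = UNIV"
    using inj_image_eq_iff[OF inj, of ?B UNIV] surj by simp
  ultimately show ?thesis
    unfolding complementary_def by (simp only:)
qed

section \<open>Lagrangians of a complex structure as reflections\<close>

text \<open>The model case: the form is represented by a skew isometry \<open>J\<close> with inverse
  \<open>- J\<close>. The normal form below reduces every symplectic form to it.\<close>

locale complex_structure =
  fixes J :: "'a::{real_inner, complete_space} \<Rightarrow> 'a"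
  assumes linear_J: "linear J"
    and J_J: "J (J x) = - x"
    and J_antisym: "J x \<bullet> y = - (x \<bullet> J y)"
begin

abbreviation form :: "'a \<Rightarrow> 'a \<Rightarrow> real" where
  "form x y \<equiv> J x \<bullet> y"

lemma norm_J [simp]: "norm (J x) = norm x"
  using J_antisym[of x "J x"] by (simp add: norm_eq_sqrt_inner J_J)

lemma bounded_linear_J: "bounded_linear J"
  using linear_J by (rule bounded_linearI_contraction) simp

text \<open>The reflections \<open>2 P - 1\<close>, where \<open>P\<close> is the orthogonal projection onto a Lagrangian subspace,
  are exactly the symmetric involutions that anticommute with \<open>J\<close>.\<close>

definition lagrangian_reflection :: "('a \<Rightarrow> 'a) \<Rightarrow> bool" where
  "lagrangian_reflection R \<longleftrightarrow> linear R \<and> (\<forall>x. R (R x) = x) \<and>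
     (\<forall>x y. R x \<bullet> y = x \<bullet> R y) \<and> (\<forall>x. R (J x) = - J (R x))"

lemma lagrangian_reflectionD:
  assumes "lagrangian_reflection R"
  shows "linear R" "R (R x) = x" "R x \<bullet> y = x \<bullet> R y" "R (J x) = - J (R x)" "norm (R x) = norm x"
  using assms by (auto simp: lagrangian_reflection_def norm_eq_sqrt_inner)

text \<open>Moving \<open>R\<close> across the inner product shows that the form equals its negative
  on fixed vectors. For maximality, \<open>J\<close> maps the -1 eigenspace of \<open>R\<close> into
  the fixed space: if \<open>z\<close> lies in an isotropic extension, then so do n = z - R z and
  \<open>J n\<close>, and pairing these two gives |n|^2 = 0.\<close>

lemma lagrangian_fixed_space:
  assumes "lagrangian_reflection R"
  shows "lagrangian form {x. R x = x}"
proof -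
  note R = lagrangian_reflectionD[OF assms]
  have "subspace {x. R x = x}"
    by (rule subspaceI) (simp_all add: linear_0[OF R(1)] linear_add[OF R(1)] linear_scale[OF R(1)])
  moreover have "J x \<bullet> y = 0" if "R x = x" "R y = y" for x y
    using R(3)[of "J x" y] R(4)[of x] that by simp
  ultimately have "isotropic form {x. R x = x}"
    by (simp add: isotropic_def)
  moreover have "S = {x. R x = x}" if S: "isotropic form S" "{x. R x = x} \<subseteq> S" for S
  proof -
    have "R z = z" if "z \<in> S" for z
    proof -
      let ?n = "z - R z"
      have sub: "subspace S" and iso: "\<And>x y. x \<in> S \<Longrightarrow> y \<in> S \<Longrightarrow> J x \<bullet> y = 0"
        using S(1) by (auto simp: isotropic_def)
      have "R (z + R z) = z + R z"
        by (simp add: linear_add[OF R(1)] R(2))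
      then have "z + R z \<in> S"
        using S(2) by blast
      then have "2 *\<^sub>R z - (z + R z) \<in> S"
        using sub that by (intro subspace_diff subspace_scale)
      then have n: "?n \<in> S"
        by (simp add: scaleR_2)
      have "R (J ?n) = J ?n"
        by (simp add: R(4) linear_diff[OF R(1)] R(2) linear_diff[OF linear_J])
      then have "J ?n \<in> S"
        using S(2) by blast
      then have "J (J ?n) \<bullet> ?n = 0"
        using n iso by blast
      then have "?n \<bullet> ?n = 0"
        by (simp only: J_J inner_minus_left neg_equal_0_iff_equal)
      then show ?thesis
        by simp
    qed
    then show ?thesis
      using S(2) by blast
  qed
  ultimately show ?thesis
    by (simp add: lagrangian_def)
qed

text \<open>Antisymmetry makes the form vanish at (z, z), so adjoining the line through
  \<open>z\<close> keeps \<open>L\<close> isotropic, and maximality applies.\<close>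

lemma lagrangian_orthogonal_mem:
  assumes L: "lagrangian form L" and z: "\<And>x. x \<in> L \<Longrightarrow> J x \<bullet> z = 0"
  shows "z \<in> L"
proof -
  have sub: "subspace L" and iso: "\<And>x y. x \<in> L \<Longrightarrow> y \<in> L \<Longrightarrow> J x \<bullet> y = 0"
    using L by (auto simp: lagrangian_def isotropic_def)
  have zz: "J z \<bullet> z = 0"
    using J_antisym[of z z] by (simp add: inner_commute)
  have zx: "J z \<bullet> x = 0" if "x \<in> L" for x
    using J_antisym[of z x] z[OF that] by (simp add: inner_commute)
  let ?S = "{x + t *\<^sub>R z |x t. x \<in> L}"
  have "subspace ?S"
  proof (rule subspaceI)
    show "0 \<in> ?S"
      using subspace_0[OF sub] by (auto intro!: exI[of _ 0])
    show "u + v \<in> ?S" if uv: "u \<in> ?S" "v \<in> ?S" for u v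
    proof -
      obtain x s y t where "u = x + s *\<^sub>R z" "v = y + t *\<^sub>R z" "x \<in> L" "y \<in> L"
        using uv by blast
      then have "u + v = (x + y) + (s + t) *\<^sub>R z" "x + y \<in> L"
        using subspace_add[OF sub] by (auto simp: algebra_simps)
      then show ?thesis
        by blast
    qed
    show "c *\<^sub>R u \<in> ?S" if u: "u \<in> ?S" for c u
    proof -
      obtain x s where "u = x + s *\<^sub>R z" "x \<in> L"
        using u by blast
      then have "c *\<^sub>R u = c *\<^sub>R x + (c * s) *\<^sub>R z" "c *\<^sub>R x \<in> L"
        using subspace_scale[OF sub] by (auto simp: algebra_simps)
      then show ?thesis
        by blast
    qed
  qed
  moreover have "J u \<bullet> v = 0" if "u \<in> ?S" "v \<in> ?S" for u v
    using that
    by (auto simp: linear_add[OF linear_J] linear_scale[OF linear_J] inner_add_left inner_add_right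
        iso z zx zz)
  ultimately have "isotropic form ?S"
    by (simp add: isotropic_def)
  moreover have "L \<subseteq> ?S"
    by (force intro: exI[of _ 0])
  ultimately have "?S = L"
    using L by (simp add: lagrangian_def)
  moreover have "0 + 1 *\<^sub>R z \<in> ?S"
    using subspace_0[OF sub] by blast
  ultimately show ?thesis
    by simp
qed

text \<open>\<open>L\<close> is its own orthogonal with respect to the form, hence an intersection
  of closed kernels and closed. Moreover \<open>J\<close> interchanges \<open>L\<close> and its
  orthogonal complement, so the reflection in \<open>L\<close> anticommutes with
  \<open>J\<close>.\<close>

lemma lagrangian_reflection_exists:
  assumes L: "lagrangian form L"
  obtains R where "lagrangian_reflection R" "L = {x. R x = x}"
proof -
  have sub: "subspace L" and iso: "\<And>x y. x \<in> L \<Longrightarrow> y \<in> L \<Longrightarrow> J x \<bullet> y = 0"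
    using L by (auto simp: lagrangian_def isotropic_def)
  have "L = (\<Inter>x\<in>L. {z. J x \<bullet> z = 0})"
    using iso lagrangian_orthogonal_mem[OF L] by blast
  moreover have "closed (\<Inter>x\<in>L. {z. J x \<bullet> z = 0})"
    by (intro closed_INT ballI closed_Collect_eq continuous_intros)
  ultimately have "closed L"
    by simp
  then obtain R where R: "linear R" "\<And>x. R (R x) = x" "\<And>x y. R x \<bullet> y = x \<bullet> R y"
    and RL: "\<And>x. x + R x \<in> L" and orth: "\<And>x y. y \<in> L \<Longrightarrow> (x - R x) \<bullet> y = 0"
    and R_eq: "\<And>a b. a \<in> L \<Longrightarrow> (\<And>y. y \<in> L \<Longrightarrow> b \<bullet> y = 0) \<Longrightarrow> R (a + b) = a - b"
    using closed_subspace_reflection[OF _ sub] by blast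
  have "R (J x) = - J (R x)" for x
  proof -
    have "J (x - R x) \<in> L"
    proof (rule lagrangian_orthogonal_mem[OF L])
      show "J y \<bullet> J (x - R x) = 0" if "y \<in> L" for y
        using orth[OF that, of x]
        by (simp only: J_antisym[of y] J_J inner_minus_right inner_commute[of y] minus_minus)
    qed
    then have "R (J (x - R x) + J (x + R x)) = J (x - R x) - J (x + R x)"
      by (rule R_eq) (rule iso[OF RL])
    then have "2 *\<^sub>R R (J x) = 2 *\<^sub>R (- J (R x))"
      by (simp add: linear_add[OF linear_J] linear_diff[OF linear_J] linear_add[OF R(1)]
          linear_diff[OF R(1)] scaleR_2)
    then show ?thesis
      by (metis scaleR_cancel_left zero_neq_numeral)
  qed
  then have "lagrangian_reflection R"
    using R by (simp add: lagrangian_reflection_def)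
  moreover have "R x = x" if "x \<in> L" for x
    using R_eq[OF that, of 0] by simp
  moreover have "x \<in> L" if "R x = x" for x
    using subspace_scale[OF sub RL[of x], of "1/2"] that by (simp add: scaleR_2[symmetric])
  ultimately show thesis
    using that by blast
qed

section \<open>Complementarity as a lower bound on the difference of reflections\<close>

text \<open>Being bounded below, \<open>R - S\<close> is injective with closed range; being
  symmetric, it has its kernel as orthogonal complement of the range, so it is onto. Common fixed
  vectors lie in the kernel.\<close>

lemma complementary_fixed_spaces:
  assumes R: "lagrangian_reflection R" and S: "lagrangian_reflection S"
    and c: "c > 0" "\<And>x. c * norm x \<le> norm (R x - S x)"
  shows "complementary {x. S x = x} {x. R x = x}"
proof -
  note R = lagrangian_reflectionD[OF R] and S = lagrangian_reflectionD[OF S]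
  let ?D = "\<lambda>x. R x - S x"
  have inj: "x = 0" if "?D x = 0" for x
    using c(2)[of x] that c(1) by (simp add: mult_le_0_iff)
  have linD: "linear ?D"
    using R(1) S(1) by (rule linear_compose_sub)
  have "bounded_linear ?D"
    using R S by (intro bounded_linear_sub bounded_linearI_contraction) auto
  then have "complete (range ?D)"
    using complete_isometric_image[OF c(1) subspace_UNIV, of ?D] c(2) complete_UNIV by blast
  then have "closed (range ?D)"
    by (rule complete_imp_closed)
  moreover have "subspace (range ?D)"
    using linear_subspace_image[OF linD subspace_UNIV] .
  ultimately have surj: "z \<in> range ?D" for z
  proof (rule orthogonal_decomposition[of _ z])
    fix n
    assume n: "n \<in> range ?D" "\<And>y. y \<in> range ?D \<Longrightarrow> (z - n) \<bullet> y = 0"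
    have "?D (z - n) \<bullet> ?D (z - n) = (z - n) \<bullet> ?D (?D (z - n))"
      by (simp only: inner_diff_left[of "R (z - n)"] inner_diff_right[of "z - n" "R (?D (z - n))"] R(3) S(3))
    also have "\<dots> = 0"
      by (rule n(2)) simp
    finally have "?D (z - n) = 0"
      by (simp only: inner_eq_zero_iff)
    then have "z - n = 0"
      by (rule inj)
    then show ?thesis
      using n(1) by simp
  qed
  \<comment> \<open>Writing z = R w - S w and inserting \<open>w\<close> gives the splitting
    \<open>- (w + S w) + (w + R w)\<close>.\<close>
  have "\<exists>x y. z = x + y \<and> S x = x \<and> R y = y" for z
  proof -
    obtain w where w: "z = ?D w"
      using surj by blast
    have "S (- (w + S w)) = - (w + S w)" "R (w + R w) = w + R w"
      by (simp_all add: linear_add[OF R(1)] linear_add[OF S(1)] linear_neg[OF S(1)] linear_diff[OF S(1)] R(2) S(2))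
    moreover have "z = - (w + S w) + (w + R w)"
      by (simp add: w)
    ultimately show ?thesis
      by blast
  qed
  moreover have "{x. S x = x} \<inter> {x. R x = x} = {0}"
    using inj by (auto simp: linear_0[OF R(1)] linear_0[OF S(1)])
  ultimately show ?thesis
    by (auto simp: complementary_def)
qed

text \<open>In the plane, \<open>S R\<close> is the rotation by an angle \<open>\<Theta>\<close> and the operator \<open>Y\<close> below is \<open>sin \<Theta>\<close>;
  rotating further in the direction of the sign of \<open>Y\<close> moves \<open>S R\<close> away from the identity.\<close>

lemma lagrangian_reflection_perturbation:
  assumes R: "lagrangian_reflection R" and S: "lagrangian_reflection S"
    and d: "0 < d" "d \<le> 1"
  obtains R' where "lagrangian_reflection R'" "\<And>x. norm (R' x - R x) \<le> d * norm x"
    "\<And>x. d * norm x \<le> norm (R' x - S x)"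
proof -
  note R = lagrangian_reflectionD[OF R] and S = lagrangian_reflectionD[OF S]
  have blR: "bounded_linear R" and blS: "bounded_linear S"
    using R S by (auto intro: bounded_linearI_contraction)
  define Y where "Y x = (1/2) *\<^sub>R J (R (S x) - S (R x))" for x
  note lin_simps = linear_add[OF R(1)] linear_add[OF S(1)] linear_add[OF linear_J]
    linear_diff[OF R(1)] linear_diff[OF S(1)] linear_diff[OF linear_J]
    linear_scale[OF R(1)] linear_scale[OF S(1)] linear_scale[OF linear_J]
    linear_neg[OF R(1)] linear_neg[OF S(1)] linear_neg[OF linear_J]
  have linY: "linear Y"
    unfolding Y_def by (rule linearI) (simp_all add: lin_simps algebra_simps)
  have "norm (Y x) \<le> norm x" for x
    using norm_triangle_ineq4[of "R (S x)" "S (R x)"] by (simp add: Y_def R(5) S(5))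
  moreover have "Y x \<bullet> y = x \<bullet> Y y" for x y
    by (simp add: Y_def J_antisym inner_diff_left inner_diff_right R S lin_simps)
  ultimately obtain \<Sigma> where \<Sigma>: "linear \<Sigma>" "\<And>x. \<Sigma> (\<Sigma> x) = x" "\<And>x y. \<Sigma> x \<bullet> y = x \<bullet> \<Sigma> y"
    and pos: "\<And>x. 0 \<le> Y (\<Sigma> x) \<bullet> x"
    and comm: "\<And>T T' x. bounded_linear T \<Longrightarrow> bounded_linear T' \<Longrightarrow> (\<And>x y. T x \<bullet> y = x \<bullet> T' y) \<Longrightarrow>
      (\<And>x. T (Y x) = Y (T x)) \<Longrightarrow> (\<And>x. T' (Y x) = Y (T' x)) \<Longrightarrow> T (\<Sigma> x) = \<Sigma> (T x)"
    using sign_operator[OF linY] by blast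
  have YR: "R (Y x) = Y (R x)" for x
    by (simp add: Y_def lin_simps R(2,4) algebra_simps)
  have YS: "S (Y x) = Y (S x)" for x
    by (simp add: Y_def lin_simps S(2,4) algebra_simps)
  have YJ: "J (Y x) = Y (J x)" for x
    by (simp add: Y_def lin_simps R(4) S(4) algebra_simps)
  have \<Sigma>R: "R (\<Sigma> x) = \<Sigma> (R x)" for x
    using blR blR R(3) YR YR by (rule comm)
  have \<Sigma>S: "S (\<Sigma> x) = \<Sigma> (S x)" for x
    using blS blS S(3) YS YS by (rule comm)
  \<comment> \<open>\<open>J\<close> is skew, so its adjoint is \<open>- J\<close>.\<close>
  have \<Sigma>J: "J (\<Sigma> x) = \<Sigma> (J x)" for x
  proof (rule comm[of J "\<lambda>x. - J x"])
    show "bounded_linear (\<lambda>x. - J x)"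
      using bounded_linear_J by (rule bounded_linear_minus)
  qed (simp_all add: bounded_linear_J YJ J_antisym linear_neg[OF linY])
  have n\<Sigma>: "norm (\<Sigma> x) = norm x" for x
    by (simp add: norm_eq_sqrt_inner \<Sigma>)
  \<comment> \<open>\<open>c\<close> and \<open>s\<close> are the cosine and sine of the angle whose
    chord on the unit circle has length \<open>d\<close>, that is 2 - 2 c = d^2.\<close>
  define c where "c = 1 - d\<^sup>2 / 2"
  define s where "s = sqrt (1 - c\<^sup>2)"
  have d2: "0 < d\<^sup>2" "d\<^sup>2 \<le> 1"
    using d by (simp_all add: power_le_one)
  have c0: "0 \<le> c" and c1: "c \<le> 1"
    using d2 by (auto simp: c_def)
  then have s0: "0 \<le> s" and cs: "c\<^sup>2 + s\<^sup>2 = 1"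
    by (auto simp: s_def power_le_one)
  \<comment> \<open>J \<Sigma> is skew with square -1, so \<open>V\<close> is a rotation.\<close>
  define V where "V x = c *\<^sub>R x + s *\<^sub>R J (\<Sigma> x)" for x
  have skew: "x \<bullet> J (\<Sigma> x) = 0" for x
    using J_antisym[of "\<Sigma> x" x] \<Sigma>(3)[of x "J x"] by (simp add: \<Sigma>J inner_commute)
  \<comment> \<open>Applied below with \<open>a\<close> = \<open>c - 1\<close>, to measure the
    distance from \<open>R'\<close> to \<open>R\<close>.\<close>
  have nV: "(norm (a *\<^sub>R x + s *\<^sub>R J (\<Sigma> x)))\<^sup>2 = (a\<^sup>2 + s\<^sup>2) * (norm x)\<^sup>2" for a x
  proof -
    have "(norm (a *\<^sub>R x + s *\<^sub>R J (\<Sigma> x)))\<^sup>2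
      = a\<^sup>2 * (norm x)\<^sup>2 + 2 * a * s * (x \<bullet> J (\<Sigma> x)) + s\<^sup>2 * (norm (J (\<Sigma> x)))\<^sup>2"
      unfolding power2_norm_eq_inner
      by (simp add: inner_add_left inner_add_right inner_commute[of "J (\<Sigma> x)" x] power2_eq_square algebra_simps)
    then show ?thesis
      by (simp add: skew n\<Sigma> distrib_right)
  qed
  define R' where "R' x = R (V x)" for x
  have linV: "linear V"
    unfolding V_def by (rule linearI)
      (simp_all add: lin_simps linear_add[OF \<Sigma>(1)] linear_scale[OF \<Sigma>(1)] algebra_simps)
  have R'_eq: "R' x = c *\<^sub>R R x - s *\<^sub>R J (R (\<Sigma> x))" for x
    by (simp add: R'_def V_def lin_simps R(4))
  have "linear R'"
    unfolding R'_def[abs_def] using linear_compose[OF linV R(1)] by (simp add: comp_def)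
  moreover have "R' (R' x) = x" for x
  proof -
    have RR': "R (R' x) = c *\<^sub>R x + s *\<^sub>R J (\<Sigma> x)"
      by (simp add: R'_def R(2) V_def)
    have "J (R (\<Sigma> (R' x))) = J (\<Sigma> (c *\<^sub>R x + s *\<^sub>R J (\<Sigma> x)))"
      by (simp only: \<Sigma>R RR')
    also have "\<dots> = c *\<^sub>R J (\<Sigma> x) - s *\<^sub>R x"
      by (simp add: linear_add[OF \<Sigma>(1)] linear_scale[OF \<Sigma>(1)] lin_simps \<Sigma>J[symmetric] \<Sigma>(2) J_J)
    finally have "R' (R' x) = c *\<^sub>R (c *\<^sub>R x + s *\<^sub>R J (\<Sigma> x)) - s *\<^sub>R (c *\<^sub>R J (\<Sigma> x) - s *\<^sub>R x)"
      by (simp only: R'_eq[of "R' x"] RR')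
    also have "\<dots> = (c\<^sup>2 + s\<^sup>2) *\<^sub>R x"
      by (simp add: power2_eq_square algebra_simps)
    finally have "R' (R' x) = (c\<^sup>2 + s\<^sup>2) *\<^sub>R x" .
    then show ?thesis
      by (simp add: cs)
  qed
  moreover have "R' x \<bullet> y = x \<bullet> R' y" for x y
  proof -
    have "J (R (\<Sigma> x)) \<bullet> y = x \<bullet> J (R (\<Sigma> y))"
      by (simp add: J_antisym R \<Sigma> \<Sigma>R \<Sigma>J linear_neg[OF \<Sigma>(1)])
    then show ?thesis
      by (simp add: R'_eq inner_diff_left inner_diff_right R(3))
  qed
  moreover have "R' (J x) = - J (R' x)" for x
    by (simp add: R'_eq R(4) \<Sigma>J[symmetric] lin_simps)
  ultimately have R': "lagrangian_reflection R'"
    by (simp add: lagrangian_reflection_def)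
  have "norm (R' x - R x) \<le> d * norm x" for x
  proof (rule power2_le_imp_le)
    have "R' x - R x = R ((c - 1) *\<^sub>R x + s *\<^sub>R J (\<Sigma> x))"
      by (simp add: R'_def V_def lin_simps algebra_simps)
    then have "(norm (R' x - R x))\<^sup>2 = ((c - 1)\<^sup>2 + s\<^sup>2) * (norm x)\<^sup>2"
      by (simp only: R(5) nV)
    also have "(c - 1)\<^sup>2 + s\<^sup>2 = (c\<^sup>2 + s\<^sup>2) + 1 - 2 * c"
      by (simp add: power2_eq_square algebra_simps)
    also have "\<dots> = d\<^sup>2"
      by (simp only: cs) (simp add: c_def)
    finally show "(norm (R' x - R x))\<^sup>2 \<le> (d * norm x)\<^sup>2"
      by (simp add: power_mult_distrib)
  qed (use d in simp)
  moreover have "d * norm x \<le> norm (R' x - S x)" for x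
  proof (rule power2_le_imp_le)
    \<comment> \<open>Two ways of moving operators across the inner product; their sum is twice the
      quadratic form of Y \<Sigma>, which is nonnegative. Hence the rotation term only decreases the
      inner product of \<open>R' x\<close> and \<open>S x\<close>, and |R' x - S x|^2 is at least (2
      - 2 c) |x|^2.\<close>
    have "J (R (\<Sigma> x)) \<bullet> S x = - (J (S (R (\<Sigma> x))) \<bullet> x)"
      by (simp add: S(4) S(3)[symmetric])
    moreover have "J (R (\<Sigma> x)) \<bullet> S x = J (R (S (\<Sigma> x))) \<bullet> x"
    proof -
      have "J (R (\<Sigma> x)) \<bullet> S x = - (\<Sigma> x \<bullet> R (J (S x)))"
        by (simp only: J_antisym R(3))
      also have "\<dots> = \<Sigma> x \<bullet> J (R (S x))"
        by (simp only: R(4) inner_minus_right minus_minus)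
      also have "\<dots> = x \<bullet> J (R (S (\<Sigma> x)))"
        by (simp only: \<Sigma>(3) \<Sigma>J \<Sigma>R \<Sigma>S)
      finally show ?thesis
        by (simp only: inner_commute)
    qed
    ultimately have "2 * (J (R (\<Sigma> x)) \<bullet> S x) = 2 * (Y (\<Sigma> x) \<bullet> x)"
      by (simp add: Y_def lin_simps inner_diff_left)
    then have "0 \<le> s * (J (R (\<Sigma> x)) \<bullet> S x)"
      using pos[of x] s0 by simp
    moreover have "c * (R x \<bullet> S x) \<le> c * (norm x)\<^sup>2"
      using norm_cauchy_schwarz[of "R x" "S x"] c0
      by (intro mult_left_mono) (simp_all add: R(5) S(5) power2_eq_square)
    ultimately have "R' x \<bullet> S x \<le> c * (norm x)\<^sup>2"
      by (simp add: R'_eq inner_diff_left)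
    moreover have "(norm (R' x - S x))\<^sup>2 = (norm (R' x))\<^sup>2 + (norm (S x))\<^sup>2 - 2 * (R' x \<bullet> S x)"
      unfolding power2_norm_eq_inner by (simp add: inner_diff_left inner_diff_right inner_commute)
    ultimately have "2 * (1 - c) * (norm x)\<^sup>2 \<le> (norm (R' x - S x))\<^sup>2"
      by (simp add: lagrangian_reflectionD(5)[OF R'] S(5) algebra_simps)
    then show "(d * norm x)\<^sup>2 \<le> (norm (R' x - S x))\<^sup>2"
      by (simp add: c_def power_mult_distrib)
  qed simp
  ultimately show thesis
    using that[OF R'] by blast
qed

section \<open>Completeness and the Baire category argument\<close>

text \<open>The linear conditions pass to pointwise limits directly. For the involution, x = X_n
  (X_n x - R x) + X_n (R x), and the first summand tends to 0 because each X_n is an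
  isometry.\<close>

lemma lagrangian_reflection_limit:
  assumes X: "\<And>n. lagrangian_reflection (X n)" and lim: "\<And>x. (\<lambda>n. X n x) \<longlonglongrightarrow> R x"
  shows "lagrangian_reflection R"
proof -
  note X = lagrangian_reflectionD[OF X]
  have "R (x + y) = R x + R y" for x y
    using tendsto_add[OF lim[of x] lim[of y]]
    by (intro LIMSEQ_unique[OF lim]) (simp add: linear_add[OF X(1)])
  moreover have "R (c *\<^sub>R x) = c *\<^sub>R R x" for c x
    using tendsto_scaleR[OF tendsto_const lim[of x]]
    by (intro LIMSEQ_unique[OF lim]) (simp add: linear_scale[OF X(1)])
  ultimately have "linear R"
    by (rule linearI)
  moreover have "R (R x) = x" for x
  proof -
    have "(\<lambda>n. X n (X n x - R x)) \<longlonglongrightarrow> 0"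
      using tendsto_norm_zero[OF LIM_zero[OF lim[of x]]]
      by (rule Lim_null_comparison[rotated]) (simp add: X(5))
    then have "(\<lambda>n. X n (X n x - R x) + X n (R x)) \<longlonglongrightarrow> 0 + R (R x)"
      by (rule tendsto_add[OF _ lim])
    then have "(\<lambda>n. x) \<longlonglongrightarrow> R (R x)"
      by (simp add: linear_diff[OF X(1)] X(2))
    then show ?thesis
      by (simp add: LIMSEQ_const_iff)
  qed
  moreover have "R x \<bullet> y = x \<bullet> R y" for x y
    using tendsto_inner[OF lim[of x] tendsto_const[of y]] tendsto_inner[OF tendsto_const[of x] lim[of y]]
    unfolding X(3) by (rule LIMSEQ_unique)
  moreover have "R (J x) = - J (R x)" for x
    using tendsto_minus[OF bounded_linear.tendsto[OF bounded_linear_J lim[of x]]]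
    by (intro LIMSEQ_unique[OF lim]) (simp add: X(4))
  ultimately show ?thesis
    by (simp add: lagrangian_reflection_def)
qed

lemma common_transversal_reflection:
  assumes I: "countable I" "I \<noteq> {}" and S: "\<And>n. n \<in> I \<Longrightarrow> lagrangian_reflection (S n)"
  obtains R where "lagrangian_reflection R"
    "\<And>n. n \<in> I \<Longrightarrow> \<exists>c>0. \<forall>x. c * norm x \<le> norm (R x - S n x)"
proof -
  \<comment> \<open>The operator norm is used as metric, so that nearby reflections have uniformly
    close lower bounds against each \<open>S n\<close>.\<close>
  define M :: "('a \<Rightarrow>\<^sub>L 'a) set" where "M = {F. lagrangian_reflection (blinfun_apply F)}"
  interpret M: Metric_space M dist
    by unfold_locales (auto simp: dist_commute dist_triangle)
  have BlinfunM: "Blinfun R \<in> M" "blinfun_apply (Blinfun R) = R" if "lagrangian_reflection R" for R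
  proof -
    have "bounded_linear R"
      using lagrangian_reflectionD[OF that] by (auto intro: bounded_linearI_contraction)
    then show "blinfun_apply (Blinfun R) = R"
      by (rule bounded_linear_Blinfun_apply)
    then show "Blinfun R \<in> M"
      using that by (simp add: M_def)
  qed
  have dist_bound: "dist F G \<le> e" if "\<And>x. norm (F x - G x) \<le> e * norm x" "0 \<le> e"
    for F G :: "'a \<Rightarrow>\<^sub>L 'a" and e
    unfolding dist_norm using that by (intro norm_blinfun_bound) (simp_all add: blinfun.diff_left)
  have le_dist: "norm (F x - G x) \<le> dist F G * norm x" for F G :: "'a \<Rightarrow>\<^sub>L 'a" and x
    using norm_blinfun[of "F - G" x] by (simp add: dist_norm blinfun.diff_left)
  have "M.mcomplete"
    unfolding M.mcomplete_def
  proof (intro allI impI)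
    fix \<sigma> :: "nat \<Rightarrow> 'a \<Rightarrow>\<^sub>L 'a"
    assume "M.MCauchy \<sigma>"
    then have \<sigma>M: "\<And>n. \<sigma> n \<in> M"
      and cauchy: "\<And>e. e > 0 \<Longrightarrow> \<exists>N. \<forall>m n. N \<le> m \<longrightarrow> N \<le> n \<longrightarrow> dist (\<sigma> m) (\<sigma> n) < e"
      by (auto simp: M.MCauchy_def)
    have "Cauchy (\<lambda>n. \<sigma> n x)" for x
    proof (rule metric_CauchyI)
      fix e :: real
      assume "e > 0"
      \<comment> \<open>Adding 1 keeps the divisor positive at x = 0.\<close>
      have "0 < norm x + 1"
        using norm_ge_zero[of x] by linarith
      with \<open>e > 0\<close> obtain N where N: "\<And>m n. N \<le> m \<Longrightarrow> N \<le> n \<Longrightarrow> dist (\<sigma> m) (\<sigma> n) < e / (norm x + 1)"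
        using cauchy[of "e / (norm x + 1)"] by auto
      have "dist (\<sigma> m x) (\<sigma> n x) < e" if "N \<le> m" "N \<le> n" for m n
      proof -
        have "dist (\<sigma> m x) (\<sigma> n x) \<le> dist (\<sigma> m) (\<sigma> n) * norm x"
          using le_dist[of "\<sigma> m" x "\<sigma> n"] by (simp add: dist_norm)
        also have "\<dots> \<le> dist (\<sigma> m) (\<sigma> n) * (norm x + 1)"
          by (intro mult_left_mono) auto
        also have "\<dots> < e"
          using N[OF that] \<open>0 < norm x + 1\<close> by (simp add: pos_less_divide_eq)
        finally show ?thesis .
      qed
      then show "\<exists>N. \<forall>m\<ge>N. \<forall>n\<ge>N. dist (\<sigma> m x) (\<sigma> n x) < e"
        by blast
    qed
    then have conv: "convergent (\<lambda>n. \<sigma> n x)" for x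
      by (rule Cauchy_convergent)
    define R where "R x = lim (\<lambda>n. \<sigma> n x)" for x
    have lim: "(\<lambda>n. \<sigma> n x) \<longlonglongrightarrow> R x" for x
      unfolding R_def using conv by (simp only: convergent_LIMSEQ_iff)
    have R: "lagrangian_reflection R"
    proof (rule lagrangian_reflection_limit[OF _ lim])
      show "lagrangian_reflection (blinfun_apply (\<sigma> n))" for n
        using \<sigma>M[of n] by (simp only: M_def mem_Collect_eq)
    qed
    have "\<exists>N. \<forall>n\<ge>N. \<sigma> n \<in> M \<and> dist (\<sigma> n) (Blinfun R) < e" if e: "e > 0" for e
    proof -
      obtain N where N: "\<And>m n. N \<le> m \<Longrightarrow> N \<le> n \<Longrightarrow> dist (\<sigma> m) (\<sigma> n) < e / 2"
        using cauchy[of "e / 2"] e by auto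
      \<comment> \<open>Letting m tend to infinity in the Cauchy estimate upgrades pointwise
        convergence to the operator norm; the half restores the strict inequality.\<close>
      have "dist (\<sigma> n) (Blinfun R) \<le> e / 2" if "n \<ge> N" for n
      proof (rule dist_bound)
        fix x
        have "(\<lambda>m. norm (\<sigma> n x - \<sigma> m x)) \<longlonglongrightarrow> norm (\<sigma> n x - R x)"
          by (intro tendsto_intros lim)
        moreover have "norm (\<sigma> n x - \<sigma> m x) \<le> e / 2 * norm x" if "m \<ge> N" for m
          using le_dist[of "\<sigma> n" x "\<sigma> m"] mult_right_mono[OF less_imp_le[OF N[OF \<open>n \<ge> N\<close> that]] norm_ge_zero[of x]]
          by linarith
        ultimately have "norm (\<sigma> n x - R x) \<le> e / 2 * norm x"
          by (intro LIMSEQ_le_const2) auto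
        then show "norm (\<sigma> n x - Blinfun R x) \<le> e / 2 * norm x"
          by (simp add: BlinfunM(2)[OF R])
      qed (use e in simp)
      then show ?thesis
        using \<sigma>M e by (intro exI[of _ N]) (smt (verit) field_sum_of_halves)
    qed
    then show "\<exists>F. limitin M.mtopology \<sigma> F sequentially"
      using BlinfunM(1)[OF R] by (auto simp: M.limitin_metric eventually_sequentially)
  qed
  define U where "U n = {F \<in> M. \<exists>c>0. \<forall>x. c * norm x \<le> norm (F x - S n x)}" for n
  have U_open: "openin M.mtopology (U n)" for n
    unfolding M.openin_mtopology
  proof (intro conjI allI impI)
    show "U n \<subseteq> M"
      by (auto simp: U_def)
    fix F
    assume "F \<in> U n"
    then obtain c where c: "F \<in> M" "c > 0" "\<And>x. c * norm x \<le> norm (F x - S n x)"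
      by (auto simp: U_def)
    \<comment> \<open>Moving by less than \<open>c / 2\<close> costs at most half of the lower bound
      \<open>c\<close>.\<close>
    have "G \<in> U n" if G: "G \<in> M.mball F (c / 2)" for G
    proof -
      have "c / 2 * norm x \<le> norm (G x - S n x)" for x
      proof -
        have "norm (F x - S n x) \<le> norm (F x - G x) + norm (G x - S n x)"
          using norm_triangle_ineq[of "F x - G x" "G x - S n x"] by simp
        moreover have "norm (F x - G x) \<le> c / 2 * norm x"
          using le_dist[of F x G] mult_right_mono[OF _ norm_ge_zero[of x], of "dist F G" "c / 2"] G
          by simp
        ultimately show ?thesis
          using c(3)[of x] by linarith
      qed
      then show ?thesis
        using G c(2) by (auto simp: U_def intro!: exI[of _ "c / 2"])
    qed
    then show "\<exists>r>0. M.mball F r \<subseteq> U n"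
      using c(2) by (intro exI[of _ "c / 2"]) auto
  qed
  have U_dense: "M.mtopology closure_of U n = M" if "n \<in> I" for n
  proof -
    have "\<exists>G\<in>U n. G \<in> M.mball F r" if F: "F \<in> M" and r: "r > 0" for F r
    proof -
      \<comment> \<open>The perturbation lemma asks for d \<le> 1, and membership in the open ball
        for d < r.\<close>
      define d where "d = min 1 (r / 2)"
      have d: "0 < d" "d \<le> 1" "d < r"
        using r by (auto simp: d_def)
      have "lagrangian_reflection (blinfun_apply F)"
        using F by (simp add: M_def)
      then obtain R where R: "lagrangian_reflection R" "\<And>x. norm (R x - F x) \<le> d * norm x"
        "\<And>x. d * norm x \<le> norm (R x - S n x)"
        using lagrangian_reflection_perturbation[OF _ S[OF \<open>n \<in> I\<close>] d(1,2)] by blast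
      have "dist (Blinfun R) F \<le> d"
        by (rule dist_bound) (use R d in \<open>simp_all add: BlinfunM(2)\<close>)
      then have "Blinfun R \<in> M.mball F r"
        using BlinfunM(1)[OF R(1)] F d by (simp add: dist_commute)
      moreover have "Blinfun R \<in> U n"
        using BlinfunM[OF R(1)] R(3) d(1) by (auto simp: U_def)
      ultimately show ?thesis
        by blast
    qed
    then show ?thesis
      by (auto simp: M.metric_closure_of)
  qed
  have "M.mtopology closure_of \<Inter> (U ` I) = M"
    using \<open>M.mcomplete\<close> I(1) U_open U_dense by (intro M.metric_Baire_category) auto
  \<comment> \<open>Some \<open>S n\<close> lies in \<open>M\<close>; a dense subset of a nonempty
    space is nonempty.\<close>
  moreover have "M \<noteq> {}"
    using I(2) S BlinfunM(1) by blast
  ultimately obtain F where "F \<in> \<Inter> (U ` I)"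
    by (metis all_not_in_conv closure_of_empty)
  then show thesis
    using that[of "blinfun_apply F"] I(2) by (auto simp: U_def M_def)
qed

lemma common_complementary_lagrangian:
  assumes I: "countable I" "I \<noteq> {}" and L: "\<And>n. n \<in> I \<Longrightarrow> lagrangian form (L n)"
  shows "\<exists>L'. lagrangian form L' \<and> (\<forall>n\<in>I. complementary (L n) L')"
proof -
  have "\<exists>R. lagrangian_reflection R \<and> L n = {x. R x = x}" if "n \<in> I" for n
    using lagrangian_reflection_exists[OF L[OF that]] by blast
  then obtain S where S: "\<And>n. n \<in> I \<Longrightarrow> lagrangian_reflection (S n)"
    and LS: "\<And>n. n \<in> I \<Longrightarrow> L n = {x. S n x = x}"
    by metis
  obtain R where R: "lagrangian_reflection R"
    and c: "\<And>n. n \<in> I \<Longrightarrow> \<exists>c>0. \<forall>x. c * norm x \<le> norm (R x - S n x)"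
    using common_transversal_reflection[where S = S, OF I S] by blast
  have "complementary (L n) {x. R x = x}" if "n \<in> I" for n
    using c[OF that] complementary_fixed_spaces[OF R S[OF that]] LS[OF that] by auto
  then show ?thesis
    using lagrangian_fixed_space[OF R] by blast
qed

end

section \<open>Polar decomposition and the normal form\<close>

text \<open>Polar decomposition H = J A with \<open>A\<close> the positive square root of -H^2,
  followed by A = G^2. Since \<open>G\<close> is symmetric and commutes with \<open>H\<close>, one
  factor \<open>G\<close> can be moved to each argument of the form.\<close>

lemma symplectic_normal_form:
  fixes \<omega> :: "'a::{real_inner, complete_space} \<Rightarrow> 'a \<Rightarrow> real"
  assumes "symplectic_form \<omega>"
  obtains J G :: "'a \<Rightarrow> 'a" and c where "complex_structure J" "linear G" "bij G" "c \<noteq> 0"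
    "\<And>x y. \<omega> x y = c * (J (G x) \<bullet> G y)"
proof -
  obtain H0 where bb: "bounded_bilinear \<omega>" and anti: "\<And>x y. \<omega> x y = - \<omega> y x"
    and H0: "linear H0" "bij H0" "\<And>x y. \<omega> x y = H0 x \<bullet> y"
    using assms unfolding symplectic_form_def by blast
  obtain K where K: "K > 0" "\<And>x y. norm (\<omega> x y) \<le> norm x * norm y * K"
    using bounded_bilinear.pos_bounded[OF bb] by blast
  \<comment> \<open>Division by the bound \<open>K\<close> makes \<open>H\<close> a contraction, as
    the square root iteration requires.\<close>
  define H where "H x = (1/K) *\<^sub>R H0 x" for x
  have linH: "linear H"
    unfolding H_def by (rule linearI) (simp_all add: linear_add[OF H0(1)] linear_scale[OF H0(1)] algebra_simps)
  have "bij (\<lambda>x :: 'a. (1/K) *\<^sub>R x)"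
    by (rule bij_betw_byWitness[of _ "\<lambda>x. K *\<^sub>R x"]) (use K(1) in auto)
  then have bijH: "bij H"
    using bij_comp[OF H0(2)] by (simp add: H_def[abs_def] comp_def)
  have \<omega>_H: "\<omega> x y = K * (H x \<bullet> y)" for x y
    using K(1) by (simp add: H_def H0(3))
  have antiH: "H x \<bullet> y = - (x \<bullet> H y)" for x y
  proof -
    have "K * (H x \<bullet> y) = K * (- (x \<bullet> H y))"
      using anti[of x y] by (simp add: \<omega>_H inner_commute)
    then show ?thesis
      using K(1) by (simp only: mult_cancel_left) simp
  qed
  have nH: "norm (H x) \<le> norm x" for x
  proof -
    have "K * (norm (H x))\<^sup>2 \<le> norm x * norm (H x) * K"
      using K(2)[of x "H x"] K(1) by (simp add: \<omega>_H power2_norm_eq_inner)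
    then have "norm (H x) * norm (H x) \<le> norm x * norm (H x)"
      using K(1) by (simp add: power2_eq_square mult.commute)
    then show ?thesis
      by (cases "H x = 0") auto
  qed
  have blH: "bounded_linear H"
    using linH nH by (rule bounded_linearI_contraction)
  \<comment> \<open>Here 1 - B = -H^2, so \<open>1 - Z\<close> will be |H|.\<close>
  let ?B = "\<lambda>x. x + H (H x)"
  have linB: "linear ?B"
    by (rule linearI) (simp_all add: linear_add[OF linH] linear_scale[OF linH] algebra_simps)
  obtain Z where Z: "linear Z" "\<And>x. norm (Z x) \<le> norm x" "\<And>x y. Z x \<bullet> y = x \<bullet> Z y"
    and rootZ: "\<And>x. (x - Z x) - Z (x - Z x) = x - ?B x"
    and commZ: "\<And>T x. bounded_linear T \<Longrightarrow> (\<And>y. T (?B y) = ?B (T y)) \<Longrightarrow> T (Z x) = Z (T x)"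
  proof (rule contraction_square_root[of ?B])
    show "norm (?B x) \<le> norm x" for x
      using norm_diff_adjoint_square_le[of H "\<lambda>x. - H x" x] nH by (simp add: antiH)
    show "?B x \<bullet> y = x \<bullet> ?B y" for x y
      by (simp add: inner_add_left inner_add_right antiH)
  qed (use linB in auto)
  \<comment> \<open>A second extraction, now with \<open>Z\<close> in place of \<open>B\<close>:
    \<open>1 - W\<close> is a square root of \<open>1 - Z\<close>.\<close>
  obtain W where W: "linear W" "\<And>x. norm (W x) \<le> norm x" "\<And>x y. W x \<bullet> y = x \<bullet> W y"
    and rootW: "\<And>x. (x - W x) - W (x - W x) = x - Z x"
    and commW: "\<And>T x. bounded_linear T \<Longrightarrow> (\<And>y. T (Z y) = Z (T y)) \<Longrightarrow> T (W x) = W (T x)"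
    using contraction_square_root[OF Z(1-3)] by blast
  define A where "A x = x - Z x" for x
  define G where "G x = x - W x" for x
  have linA: "linear A" and linG: "linear G"
    unfolding A_def G_def using Z(1) W(1) by (auto intro!: linear_compose_sub linear_ident)
  have AA: "A (A x) = - H (H x)" for x
    using rootZ[of x] by (simp add: A_def)
  have GG: "G (G x) = A x" for x
    using rootW[of x] by (simp add: A_def G_def)
  have HZ: "H (Z x) = Z (H x)" for x
    using blH by (rule commZ) (simp add: linear_add[OF linH])
  then have HW: "H (W x) = W (H x)" for x
    by (intro commW[OF blH])
  have HA: "H (A x) = A (H x)" and HG: "H (G x) = G (H x)" for x
    by (simp_all add: A_def G_def linear_diff[OF linH] HZ HW)
  have symA: "A x \<bullet> y = x \<bullet> A y" and symG: "G x \<bullet> y = x \<bullet> G y" for x y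
    by (simp_all add: A_def G_def inner_diff_left inner_diff_right Z(3) W(3))
  have bij_square: "bij f" if ff: "bij (\<lambda>x. f (f x))" for f :: "'a \<Rightarrow> 'a"
  proof (rule bijI')
    show "f x = f y \<longleftrightarrow> x = y" for x y
      using injD[OF bij_is_inj[OF ff], of x y] by auto
    show "\<exists>x. y = f x" for y
      using surjD[OF bij_is_surj[OF ff], of y] by blast
  qed
  have "bij (\<lambda>x. - H (H x))"
    using bij_comp[OF bij_comp[OF bijH bijH] bij_uminus] by (simp add: comp_def)
  then have bijA: "bij A"
    using bij_square[of A] by (simp only: AA)
  then have bijG: "bij G"
    using bij_square[of G] by (simp only: GG)
  define J where "J x = H (inv A x)" for x
  have JA: "J (A x) = H x" for x
    using bijA by (simp add: J_def bij_is_inj inv_f_f)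
  \<comment> \<open>Every vector has the form \<open>A u\<close>, on which \<open>J\<close> acts by
    J (A u) = H u; the axioms for \<open>J\<close> thus reduce to identities for \<open>H\<close>
    and \<open>A\<close>.\<close>
  have surjA: "\<exists>u. x = A u" for x
    using bijA by (metis bij_pointE)
  have "complex_structure J"
  proof
    show "J (x + y) = J x + J y" for x y
      using surjA[of x] surjA[of y] by (auto simp: JA linear_add[OF linA, symmetric] linear_add[OF linH])
    show "J (r *\<^sub>R x) = r *\<^sub>R J x" for r x
      using surjA[of x] by (auto simp: JA linear_scale[OF linA, symmetric] linear_scale[OF linH])
    show "J (J x) = - x" for x
    proof -
      obtain u v where uv: "x = A u" "u = A v"
        using surjA by blast
      have "J (J x) = H (H v)"
        by (simp add: uv JA HA)
      then show ?thesis
        by (simp add: uv AA)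
    qed
    show "J x \<bullet> y = - (x \<bullet> J y)" for x y
    proof -
      obtain u v where uv: "x = A u" "y = A v"
        using surjA by blast
      then show ?thesis
        by (simp add: JA symA antiH HA)
    qed
  qed
  moreover have "\<omega> x y = K * (J (G x) \<bullet> G y)" for x y
  proof -
    obtain u where u: "x = G u"
      using bijG by (metis bij_pointE)
    have "J (G x) \<bullet> G y = G (H u) \<bullet> y"
      by (simp add: u GG JA symG)
    then show ?thesis
      by (simp add: \<omega>_H u HG)
  qed
  ultimately show thesis
    using that linG bijG K(1) by (metis less_irrefl)
qed

theorem mainTheorem1:
  fixes \<omega> :: "'a::{real_inner, complete_space} \<Rightarrow> 'a \<Rightarrow> real"
    and I :: "'i set"
    and L :: "'i \<Rightarrow> 'a set"
  assumes "symplectic_form \<omega>"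
    and "countable I"
    and "\<And>n. n \<in> I \<Longrightarrow> lagrangian \<omega> (L n)"
  shows "\<exists>L'. lagrangian \<omega> L' \<and> (\<forall>n\<in>I. complementary (L n) L')"
proof (cases "I = {}")
  case True
  then show ?thesis
    using lagrangian_exists assms(1) by (auto simp: symplectic_form_def)
next
  case False
  obtain J G :: "'a \<Rightarrow> 'a" and c where J: "complex_structure J" and G: "linear G" "bij G"
    and c: "c \<noteq> 0" "\<And>x y. \<omega> x y = c * (J (G x) \<bullet> G y)"
    using symplectic_normal_form[OF assms(1)] by blast
  interpret complex_structure J
    by (fact J)
  have lag: "lagrangian form (G ` S) \<longleftrightarrow> lagrangian \<omega> S" for S
    using G by (rule lagrangian_image_iff) (simp add: c)
  obtain M where M: "lagrangian form M" "\<And>n. n \<in> I \<Longrightarrow> complementary (G ` L n) M"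
    using common_complementary_lagrangian[OF assms(2) False, of "\<lambda>n. G ` L n"] assms(3) lag by blast
  \<comment> \<open>The preimage of \<open>M\<close> under \<open>G\<close> is the Lagrangian sought
    for \<omega>.\<close>
  have "M = G ` (G -` M)"
    using G(2) by (simp add: bij_is_surj surj_image_vimage_eq)
  then show ?thesis
    using M lag complementary_image_iff[OF G] by metis
qed

end
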